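(* Let $\mathcal F:\mathbb R^n\times\mathbb R^n\to\mathbb R^n$ be $C^2$ near $(0,0)$ with $\mathcal F(0,0)=0$, put $L=D\mathcal F(0,0)$ and $N(a,b)=\mathcal F(a,b)-L(a,b)$, and let $C_N$ be a constant such that on a fixed convex neighborhood of the origin $$\|N(a,b)\|\le C_N(\|a\|+\|b\|)^2,\qquad \|N(a,b)-N(\tilde a,\tilde b)\|\le C_N(\|a\|+\|b\|+\|\tilde a\|+\|\tilde b\|)(\|a-\tilde a\|+\|b-\tilde b\|).$$ Let $\mathsf B_0,\mathsf B_T\in\mathbb R^{n\times n}$ be such that $(L,\mathsf B_0,\mathsf B_T)$ has the uniform Green property with constants $(C_G,\gamma,T_0)$. Fix $0<\alpha<\gamma/2$. Let $\mathcal B:\mathbb R^n\times\mathbb R^n\to\mathbb R^n$ be $C^2$ near the origin with bounded second derivative, $\mathcal B(0,0)=0$ and $D\mathcal B(0,0)[a,b]=\mathsf B_0a+\mathsf B_Tb$ (the affine row is allowed). Put $R_B(a,b)=\mathcal B(a,b)-\mathsf B_0a-\mathsf B_Tb$ and choose $C_B$ such that on the fixed neighborhood $$\|R_B(a,b)\|\le C_B(\|a\|+\|b\|)^2,\qquad \|R_B(a,b)-R_B(\tilde a,\tilde b)\|\le C_B\,(\|a\|+\|b\|+\|\tilde a\|+\|\tilde b\|)\,(\|a-\tilde a\|+\|b-\tilde b\|).$$ Set $c=C_G$ and $$a=2C_GC_{\rm conv}C_N(1+e^\alpha)^2+16C_GC_B .$$ Choose any $R_*>0$ such that the weighted ball $\{\|z\|_{w,T}\le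 R_*\}$ lies in the fixed smoothness tube for all $T\ge T_0$ and $2aR_*<1$, and define $\delta_*:=(R_*-aR_*^2)/c$. Then for every $T\ge T_0$ and every $\Delta\in\mathbb R^n$ with $d:=\|\Delta\|<\delta_*$, the problem $$\mathcal F(z_t,z_{t+1})=0\ (0\le t<T),\qquad \mathcal B(z_0,z_T)=\Delta$$ has a solution $z=z(\Delta)=(z_0,\dots,z_T)$ in the ball $$\|z\|_{w,T}\le R_-(d):=\frac{1-\sqrt{1-4acd}}{2a}<R_*$$ (with the convention $R_-(d)=cd$ if $a=0$), and it is the only solution in $\|z\|_{w,T}\le R_*$. Let $z^{\rm lin}(\Delta):=\mathcal L_T^{\rm bd}\Delta$ and $E_t(\Delta):=z_t(\Delta)-z_t^{\rm lin}(\Delta)$. There is a constant $C$, independent of $T$, such that for all $T\ge T_0$, $0\le t\le T$ and all $\Delta,\Delta_1,\Delta_2$ of norm less than $\delta_*$: $$\|z_t(\Delta)\|\le Cw_T(t)\|\Delta\|+Cw_T(t)^2\|\Delta\|^2,$$ $$\|E_t(\Delta)\|\le Cw_T(t)^2\|\Delta\|^2,$$ $$\|z_t(\Delta_1)-z_t(\Delta_2)\|\le Cw_T(t)\|\Delta_1-\Delta_2\|,$$ $$\|E_t(\Delta_1)-E_t(\Delta_2)\|\le Cw_T(t)^2(\|\Delta_1\|+\|\Delta_2\|)\,\|\Delta_1-\Delta_2\|.$$ Consequently the solution family $\Delta\mapsto z(\Delta)$ (with values in trajectories normed by $\|\cdot\|_{w,T}$) is Fréchet differentiable at $0$ uniformly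 in $T$, with derivative $\mathcal L_T^{\rm bd}$.
   Context: Uniform Green property. Fix norms on the finite-dimensional spaces. Let $L:\mathbb R^n\times\mathbb R^n\to\mathbb R^n$ be linear and $\mathsf B_0,\mathsf B_T\in\mathbb R^{n\times n}$ fixed (the subscript $T$ in $\mathsf B_T$ is only a label). Given $C_G\ge1$, $\gamma>0$ and an integer $T_0\ge1$, the triple $(L,\mathsf B_0,\mathsf B_T)$ has the uniform Green property with constants $(C_G,\gamma,T_0)$ if for every integer $T\ge T_0$, all $f_0,\dots,f_{T-1}\in\mathbb R^n$ and $b\in\mathbb R^n$: (WP) the problem $L[h_t,h_{t+1}]=f_t$ $(0\le t<T)$, $\mathsf B_0h_0+\mathsf B_Th_T=b$ has a unique solution $h=(h_0,\dots,h_T)$; (G) with $\kappa_T(t,s)=e^{-\gamma|t-s|}+e^{-\gamma(t+T-s)}+e^{-\gamma(T-t+s)}$, this solution satisfies for all $0\le t\le T$ $$\|h_t\|\le C_G\Bigl[(e^{-\gamma t}+e^{-\gamma(T-t)})\|b\|+\sum_{s=0}^{T-1}\kappa_T(t,s)\|f_s\|\Bigr].$$ $\mathcal L_T^{\rm bd}b$ denotes the solution with $f=0$ and boundary datum $b$. Weights. $w_T(t)=e^{-\alpha t}+e^{-\alpha(T-t)}$ and $\|z\|_{w,T}=\sup_{0\le t\le T}\|z_t\|/w_T(t)$ for $z=(z_0,\dots,z_T)\in(\mathbb R^n)^{T+1}$. $C_{\rm conv}$ is a constant independent of $T,t$ with $\sum_{s=0}^{T-1}\kappa_T(t,s)w_T(s)^2\le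 C_{\rm conv}w_T(t)^2$ and $e^{-\gamma t}+e^{-\gamma(T-t)}\le C_{\rm conv}w_T(t)^2$ for $0\le t\le T$; for example, with $q_-=e^{-(\gamma-2\alpha)}$, $q_+=e^{-(\gamma+2\alpha)}$, one may use $C_{\rm conv}=4\bigl(\tfrac1{1-q_-}+\tfrac{q_+}{1-q_+}\bigr)$. "The weighted ball lies in the fixed smoothness tube" means: for every $T\ge T_0$ and every $z$ with $\|z\|_{w,T}\le R_*$, all pairs $(z_t,z_{t+1})$ and $(z_0,z_T)$ lie in the fixed convex neighborhoods of the origin on which $\mathcal F,\mathcal B$ are $C^2$ and on which the bounds $\|N(a,b)\|\le C_N(\|a\|+\|b\|)^2$, $\|N(a,b)-N(\tilde a,\tilde b)\|\le C_N(\|a\|+\|b\|+\|\tilde a\|+\|\tilde b\|)(\|a-\tilde a\|+\|b-\tilde b\|)$, $\|R_B(a,b)\|\le C_B(\|a\|+\|b\|)^2$ and $\|R_B(a,b)-R_B(\tilde a,\tilde b)\|\le C_B(\|a\|+\|b\|+\|\tilde a\|+\|\tilde b\|)(\|a-\tilde a\|+\|b-\tilde b\|)$ hold. "Fréchet differentiable at $0$ uniformly in $T$ with derivative $\mathcal L_T^{\rm bd}$" means $\sup_{T\ge T_0}\|z(\Delta)-\mathcal L_T^{\rm bd}\Delta\|_{w,T}=o(\|\Delta\|)$ as $\Delta\to0$. *)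

theory Defs
  imports "HOL-Analysis.Analysis"
begin

text \<open>The norm on \<open>\<real>\<^sup>n\<close> is an arbitrary fixed norm \<open>nrm\<close>, not necessarily the Euclidean one.
  Topology and derivatives are those of the type \<open>real ^ 'n\<close>; in finite dimension they do not
  depend on the norm.\<close>

definition is_norm :: "('a::real_vector \<Rightarrow> real) \<Rightarrow> bool" where
  "is_norm nrm \<longleftrightarrow>
     (\<forall>x. nrm x = 0 \<longleftrightarrow> x = 0) \<and>
     (\<forall>x y. nrm (x + y) \<le> nrm x + nrm y) \<and>
     (\<forall>r x. nrm (r *\<^sub>R x) = \<bar>r\<bar> * nrm x)"

definition C2_derivs ::
  "'a::real_normed_vector set \<Rightarrow> ('a \<Rightarrow> 'b::real_normed_vector) \<Rightarrow>
   ('a \<Rightarrow> 'a \<Rightarrow>\<^sub>L 'b) \<Rightarrow> ('a \<Rightarrow> 'a \<Rightarrow>\<^sub>L ('a \<Rightarrow>\<^sub>L 'b)) \<Rightarrow> bool" where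
  "C2_derivs U f f' f'' \<longleftrightarrow>
     (\<forall>x\<in>U. (f has_derivative blinfun_apply (f' x)) (at x)) \<and>
     (\<forall>x\<in>U. (f' has_derivative blinfun_apply (f'' x)) (at x)) \<and>
     continuous_on U f''"

definition C2_on :: "'a::real_normed_vector set \<Rightarrow> ('a \<Rightarrow> 'b::real_normed_vector) \<Rightarrow> bool" where
  "C2_on U f \<longleftrightarrow> (\<exists>f' f''. C2_derivs U f f' f'')"

definition C2_bounded_on ::
  "'a::real_normed_vector set \<Rightarrow> ('a \<Rightarrow> 'b::real_normed_vector) \<Rightarrow> bool" where
  "C2_bounded_on U f \<longleftrightarrow> (\<exists>f' f''. C2_derivs U f f' f'' \<and> bounded (f'' ` U))"

definition quadratic_bounds ::
  "('a::real_vector \<Rightarrow> real) \<Rightarrow> ('a \<times> 'a) set \<Rightarrow> real \<Rightarrow> ('a \<times> 'a \<Rightarrow> 'a) \<Rightarrow> bool" where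
  "quadratic_bounds nrm U K N \<longleftrightarrow>
     (\<forall>x y. (x, y) \<in> U \<longrightarrow> nrm (N (x, y)) \<le> K * (nrm x + nrm y)\<^sup>2) \<and>
     (\<forall>x y x' y'. (x, y) \<in> U \<longrightarrow> (x', y') \<in> U \<longrightarrow>
        nrm (N (x, y) - N (x', y')) \<le>
          K * (nrm x + nrm y + nrm x' + nrm y') * (nrm (x - x') + nrm (y - y')))"

text \<open>A trajectory \<open>(z\<^sub>0, \<dots>, z\<^sub>T)\<close> is encoded as a sequence that vanishes after time \<open>T\<close>, so that
  equality of trajectories is equality of functions and \<open>traj T\<close> is a copy of the
  \<open>(T+1)\<close>-fold product.\<close>

definition traj :: "nat \<Rightarrow> (nat \<Rightarrow> 'a::zero) set" where
  "traj T = {z. \<forall>t>T. z t = 0}"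

definition linear_bvp ::
  "((real^'n) \<times> (real^'n) \<Rightarrow> real^'n) \<Rightarrow> real^'n^'n \<Rightarrow> real^'n^'n \<Rightarrow> nat \<Rightarrow>
   (nat \<Rightarrow> real^'n) \<Rightarrow> real^'n \<Rightarrow> (nat \<Rightarrow> real^'n) \<Rightarrow> bool" where
  "linear_bvp L B\<^sub>0 B\<^sub>T T f b h \<longleftrightarrow>
     h \<in> traj T \<and> (\<forall>t<T. L (h t, h (Suc t)) = f t) \<and> B\<^sub>0 *v h 0 + B\<^sub>T *v h T = b"

definition green_kernel :: "real \<Rightarrow> nat \<Rightarrow> nat \<Rightarrow> nat \<Rightarrow> real" where
  "green_kernel \<gamma> T t s =
     exp (- \<gamma> * \<bar>real t - real s\<bar>) + exp (- \<gamma> * (real t + real T - real s))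
       + exp (- \<gamma> * (real T - real t + real s))"

definition uniform_green ::
  "(real^'n \<Rightarrow> real) \<Rightarrow> ((real^'n) \<times> (real^'n) \<Rightarrow> real^'n) \<Rightarrow> real^'n^'n \<Rightarrow> real^'n^'n \<Rightarrow>
   real \<Rightarrow> real \<Rightarrow> nat \<Rightarrow> bool" where
  "uniform_green nrm L B\<^sub>0 B\<^sub>T C\<^sub>G \<gamma> T\<^sub>0 \<longleftrightarrow>
     (\<forall>T\<ge>T\<^sub>0. \<forall>f b.
        (\<exists>!h. linear_bvp L B\<^sub>0 B\<^sub>T T f b h) \<and>
        (\<forall>h. linear_bvp L B\<^sub>0 B\<^sub>T T f b h \<longrightarrow>
           (\<forall>t\<le>T. nrm (h t) \<le>
              C\<^sub>G * ((exp (- \<gamma> * real t) + exp (- \<gamma> * (real T - real t))) * nrm b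
                    + (\<Sum>s<T. green_kernel \<gamma> T t s * nrm (f s))))))"

text \<open>The operator \<open>b \<mapsto> h\<close> solving the linear problem with \<open>f = 0\<close>; meaningful only when
  that problem is uniquely solvable.\<close>

definition bd_solution ::
  "((real^'n) \<times> (real^'n) \<Rightarrow> real^'n) \<Rightarrow> real^'n^'n \<Rightarrow> real^'n^'n \<Rightarrow> nat \<Rightarrow>
   real^'n \<Rightarrow> nat \<Rightarrow> real^'n" where
  "bd_solution L B\<^sub>0 B\<^sub>T T b = (THE h. linear_bvp L B\<^sub>0 B\<^sub>T T (\<lambda>_. 0) b h)"

definition weight :: "real \<Rightarrow> nat \<Rightarrow> nat \<Rightarrow> real" where
  "weight \<alpha> T t = exp (- \<alpha> * real t) + exp (- \<alpha> * (real T - real t))"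

definition weighted_norm ::
  "('a \<Rightarrow> real) \<Rightarrow> real \<Rightarrow> nat \<Rightarrow> (nat \<Rightarrow> 'a) \<Rightarrow> real" where
  "weighted_norm nrm \<alpha> T z = (SUP t\<in>{0..T}. nrm (z t) / weight \<alpha> T t)"

definition convolution_constant :: "real \<Rightarrow> real \<Rightarrow> nat \<Rightarrow> real \<Rightarrow> bool" where
  "convolution_constant \<gamma> \<alpha> T\<^sub>0 K \<longleftrightarrow>
     (\<forall>T\<ge>T\<^sub>0. \<forall>t\<le>T.
        (\<Sum>s<T. green_kernel \<gamma> T t s * (weight \<alpha> T s)\<^sup>2) \<le> K * (weight \<alpha> T t)\<^sup>2 \<and>
        exp (- \<gamma> * real t) + exp (- \<gamma> * (real T - real t)) \<le> K * (weight \<alpha> T t)\<^sup>2)"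

definition ball_in_tube ::
  "('a::zero \<Rightarrow> real) \<Rightarrow> real \<Rightarrow> nat \<Rightarrow> real \<Rightarrow> ('a \<times> 'a) set \<Rightarrow> ('a \<times> 'a) set \<Rightarrow> bool" where
  "ball_in_tube nrm \<alpha> T\<^sub>0 R U V \<longleftrightarrow>
     (\<forall>T\<ge>T\<^sub>0. \<forall>z\<in>traj T. weighted_norm nrm \<alpha> T z \<le> R \<longrightarrow>
        (\<forall>t<T. (z t, z (Suc t)) \<in> U) \<and> (z 0, z T) \<in> V)"

definition nonlinear_bvp ::
  "('a::zero \<times> 'a \<Rightarrow> 'a) \<Rightarrow> ('a \<times> 'a \<Rightarrow> 'a) \<Rightarrow> nat \<Rightarrow> 'a \<Rightarrow> (nat \<Rightarrow> 'a) \<Rightarrow> bool" where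
  "nonlinear_bvp F B T \<Delta> z \<longleftrightarrow>
     z \<in> traj T \<and> (\<forall>t<T. F (z t, z (Suc t)) = 0) \<and> B (z 0, z T) = \<Delta>"

definition R_minus :: "real \<Rightarrow> real \<Rightarrow> real \<Rightarrow> real" where
  "R_minus a c d = (if a = 0 then c * d else (1 - sqrt (1 - 4 * a * c * d)) / (2 * a))"

text \<open>\<open>sup\<^bsub>T \<ge> T\<^sub>0\<^esub> \<parallel>z\<^sub>T(\<Delta>) - D\<^sub>T(\<Delta>)\<parallel>\<^bsub>w,T\<^esub> = o(\<parallel>\<Delta>\<parallel>)\<close> as \<open>\<Delta> \<rightarrow> 0\<close>. The supremum is taken in the
  extended reals, since a real supremum of an unbounded set would be an arbitrary value.\<close>

definition uniform_frechet_at_0 ::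
  "('a::real_normed_vector \<Rightarrow> real) \<Rightarrow> real \<Rightarrow> nat \<Rightarrow>
   (nat \<Rightarrow> 'a \<Rightarrow> nat \<Rightarrow> 'a) \<Rightarrow> (nat \<Rightarrow> 'a \<Rightarrow> nat \<Rightarrow> 'a) \<Rightarrow> bool" where
  "uniform_frechet_at_0 nrm \<alpha> T\<^sub>0 z D \<longleftrightarrow>
     (\<forall>\<epsilon>>0. \<forall>\<^sub>F \<Delta> in nhds 0.
        (SUP T\<in>{T\<^sub>0..}. ereal (weighted_norm nrm \<alpha> T (\<lambda>t. z T \<Delta> t - D T \<Delta> t)))
          \<le> ereal (\<epsilon> * nrm \<Delta>))"

end

(* A solution of the nonlinear problem is a fixed point of the map sending z to the solution h of
   the linear problem with forcing -N(z_s, z_{s+1}) and boundary datum Delta - R_B(z_0, z_T).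
   The Green bound, applied to differences, shows that this map satisfies
   |h - k| <= c |Delta - Delta'| + a (|z| + |y|) |z - y| in the weighted norm.  The ball of radius
   R_-(d), the smaller root of c d + a r^2 = r, is therefore invariant, and the map contracts with
   factor 2 a R on the ball of radius R.  The error E = z - z_lin is the image of z under the same
   map with Delta = 0; since the quadratic terms have size w_T(s)^2 and this decay survives the
   convolution with the Green kernel, the error estimates carry the weight w_T(t)^2. *)

theory Submission imports Defs begin

section \<open>Arbitrary norms and the weighted norm\<close>

locale norm_fun =
  fixes nrm :: "'a::euclidean_space \<Rightarrow> real"
  assumes is_norm: "is_norm nrm"
begin

lemma eq_zero_iff [simp]: "nrm x = 0 \<longleftrightarrow> x = 0"
  using is_norm by (auto simp: is_norm_def)

lemma zero [simp]: "nrm 0 = 0"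
  by simp

lemma triangle: "nrm (x + y) \<le> nrm x + nrm y"
  using is_norm by (auto simp: is_norm_def)

lemma scaleR: "nrm (r *\<^sub>R x) = \<bar>r\<bar> * nrm x"
  using is_norm by (auto simp: is_norm_def)

lemma minus [simp]: "nrm (- x) = nrm x"
  using scaleR[of "-1" x] by simp

lemma minus_commute: "nrm (x - y) = nrm (y - x)"
  by (metis minus minus_diff_eq)

lemma nonneg [simp]: "0 \<le> nrm x"
  using triangle[of x "- x"] by simp

lemma triangle_sub: "nrm (x - y) \<le> nrm x + nrm y"
  using triangle[of x "- y"] by simp

lemma diff_triangle: "nrm (x - z) \<le> nrm (x - y) + nrm (y - z)"
  using triangle[of "x - y" "y - z"] by simp

text \<open>A norm is convex, and a finite convex function on an open subset of a finite-dimensional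
  space is continuous.\<close>

lemma continuous_on: "continuous_on UNIV nrm"
proof (rule convex_on_continuous[OF open_UNIV])
  show "convex_on UNIV nrm"
  proof (rule convex_onI)
    fix t :: real and x y :: 'a
    assume "0 < t" "t < 1"
    then show "nrm ((1 - t) *\<^sub>R x + t *\<^sub>R y) \<le> (1 - t) * nrm x + t * nrm y"
      using triangle[of "(1 - t) *\<^sub>R x" "t *\<^sub>R y"] by (simp add: scaleR)
  qed simp
qed

lemma tendsto: "(f \<longlongrightarrow> x) G \<Longrightarrow> ((\<lambda>k. nrm (f k)) \<longlongrightarrow> nrm x) G"
  using continuous_on by (auto intro: continuous_on_tendsto_compose)

text \<open>The half of norm equivalence that makes sequences Cauchy for \<open>nrm\<close> also
  Cauchy in the Euclidean sense. The factor is the reciprocal of the minimum of \<open>nrm\<close>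
  over the compact Euclidean unit sphere, which is positive because \<open>nrm\<close> vanishes only
  at 0.\<close>

lemma norm_le_nrm:
  obtains k where "k > 0" "\<And>x. norm x \<le> k * nrm x"
proof -
  have ne: "sphere (0::'a) 1 \<noteq> {}"
    using ex_in_conv by fastforce
  obtain u where u: "u \<in> sphere 0 1" "\<And>y. y \<in> sphere 0 1 \<Longrightarrow> nrm u \<le> nrm y"
    using continuous_attains_inf[OF compact_sphere ne continuous_on_subset[OF continuous_on]]
    by (metis top_greatest)
  have "u \<noteq> 0"
    using u(1) by auto
  then have pos: "nrm u > 0"
    using nonneg[of u] eq_zero_iff[of u] by linarith
  have "norm x \<le> 1 / nrm u * nrm x" for x
  proof (cases "x = 0")
    case False
    have "nrm u \<le> nrm ((1 / norm x) *\<^sub>R x)"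
      using False by (intro u(2)) auto
    also have "\<dots> = nrm x / norm x"
      by (simp add: scaleR)
    finally show ?thesis
      using False pos by (simp add: field_simps)
  qed simp
  then show thesis
    using pos that[of "1 / nrm u"] by simp
qed

end

section \<open>The exponential weight and the weighted supremum norm\<close>

lemma weight_pos [simp]: "0 < weight \<alpha> T t"
  by (simp add: weight_def add_pos_pos)

lemma weight_neq_0 [simp]: "weight \<alpha> T t \<noteq> 0"
  using less_imp_neq[OF weight_pos] by metis

lemma weight_nonneg [simp]: "0 \<le> weight \<alpha> T t"
  using weight_pos less_imp_le by blast

lemma weight_le_2: "0 \<le> \<alpha> \<Longrightarrow> t \<le> T \<Longrightarrow> weight \<alpha> T t \<le> 2"
  unfolding weight_def
  using add_mono[of "exp (- \<alpha> * real t)" 1 "exp (- \<alpha> * (real T - real t))" 1] by simp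

text \<open>Trades one factor of the weight for its bound 2; this is where the factor 2 in the first
  summand of \<open>a\<close> comes from.\<close>

lemma weight_square_le:
  assumes "0 \<le> \<alpha>" "t \<le> T"
  shows "(weight \<alpha> T t)\<^sup>2 \<le> 2 * weight \<alpha> T t"
  using mult_right_mono[OF weight_le_2[OF assms] weight_nonneg[of \<alpha> T t]]
  by (simp add: power2_eq_square)

text \<open>Moving one step forward shrinks the exponential attached to time 0 and multiplies the
  one attached to time \<open>T\<close> by exactly \<open>exp \<alpha>\<close>.\<close>

lemma weight_Suc_le:
  assumes "0 \<le> \<alpha>"
  shows "weight \<alpha> T (Suc t) \<le> exp \<alpha> * weight \<alpha> T t"
proof -
  have "exp (- \<alpha> * real (Suc t)) \<le> exp (\<alpha> + - \<alpha> * real t)"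
    using assms by (simp add: algebra_simps)
  moreover have "exp (- \<alpha> * (real T - real (Suc t))) = exp (\<alpha> + - \<alpha> * (real T - real t))"
    by (simp add: algebra_simps)
  ultimately show ?thesis
    by (simp add: weight_def distrib_left flip: exp_add)
qed

text \<open>The supremum runs over a finite nonempty set and the weight is positive, so no
  boundedness condition is needed. All estimates of the weighted norm are proved pointwise in this
  form.\<close>

lemma weighted_norm_le_iff:
  "weighted_norm nrm \<alpha> T z \<le> r \<longleftrightarrow> (\<forall>t\<le>T. nrm (z t) \<le> r * weight \<alpha> T t)"
  unfolding weighted_norm_def
  by (subst cSUP_le_iff) (auto simp: pos_divide_le_eq)

lemma weighted_norm_bound: "t \<le> T \<Longrightarrow> nrm (z t) \<le> weighted_norm nrm \<alpha> T z * weight \<alpha> T t"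
  using weighted_norm_le_iff[of nrm \<alpha> T z "weighted_norm nrm \<alpha> T z"] by auto

context norm_fun
begin

lemma weighted_norm_nonneg [simp]: "0 \<le> weighted_norm nrm \<alpha> T z"
proof -
  have "0 \<le> weighted_norm nrm \<alpha> T z * weight \<alpha> T 0"
    using weighted_norm_bound[of 0 T nrm z \<alpha>] nonneg[of "z 0"] by linarith
  then show ?thesis
    using weight_pos[of \<alpha> T 0] by (simp add: zero_le_mult_iff del: weight_pos)
qed

lemma weighted_norm_zero [simp]: "weighted_norm nrm \<alpha> T (\<lambda>_. 0) = 0"
  by (intro antisym) (simp_all add: weighted_norm_le_iff)

lemma weighted_norm_diff_triangle:
  "weighted_norm nrm \<alpha> T (\<lambda>t. x t - z t)
     \<le> weighted_norm nrm \<alpha> T (\<lambda>t. x t - y t) + weighted_norm nrm \<alpha> T (\<lambda>t. y t - z t)"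
  unfolding weighted_norm_le_iff[of nrm \<alpha> T "\<lambda>t. x t - z t"]
proof safe
  fix t assume "t \<le> T"
  then show "nrm (x t - z t) \<le> (weighted_norm nrm \<alpha> T (\<lambda>t. x t - y t)
      + weighted_norm nrm \<alpha> T (\<lambda>t. y t - z t)) * weight \<alpha> T t"
    using diff_triangle[of "x t" "z t" "y t"]
      weighted_norm_bound[of t T nrm "\<lambda>t. x t - y t" \<alpha>]
      weighted_norm_bound[of t T nrm "\<lambda>t. y t - z t" \<alpha>]
    by (simp add: distrib_right)
qed

lemma weighted_norm_diff_eq_0:
  assumes "x \<in> traj T" "y \<in> traj T" "weighted_norm nrm \<alpha> T (\<lambda>t. x t - y t) \<le> 0"
  shows "x = y"
proof
  fix t
  show "x t = y t"
  proof (cases "t \<le> T")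
    case True
    then have "nrm (x t - y t) \<le> 0"
      using assms(3) by (simp add: weighted_norm_le_iff)
    then have "nrm (x t - y t) = 0"
      using nonneg[of "x t - y t"] by linarith
    then show ?thesis
      by simp
  qed (use assms in \<open>auto simp: traj_def\<close>)
qed

section \<open>Weighted balls of trajectories as complete metric spaces\<close>

definition traj_ball :: "real \<Rightarrow> nat \<Rightarrow> real \<Rightarrow> (nat \<Rightarrow> 'a) set" where
  "traj_ball \<alpha> T r = {z \<in> traj T. weighted_norm nrm \<alpha> T z \<le> r}"

text \<open>Only times up to \<open>T\<close> are seen; distance 0 forces equality because members
  of \<open>traj T\<close> vanish afterwards.\<close>

definition traj_dist :: "real \<Rightarrow> nat \<Rightarrow> (nat \<Rightarrow> 'a) \<Rightarrow> (nat \<Rightarrow> 'a) \<Rightarrow> real" where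
  "traj_dist \<alpha> T x y = weighted_norm nrm \<alpha> T (\<lambda>t. x t - y t)"

lemma Metric_space_traj_ball: "Metric_space (traj_ball \<alpha> T r) (traj_dist \<alpha> T)"
proof
  show "traj_dist \<alpha> T x y = traj_dist \<alpha> T y x" for x y
    by (simp add: traj_dist_def weighted_norm_def minus_commute)
  show "traj_dist \<alpha> T x y = 0 \<longleftrightarrow> x = y"
    if "x \<in> traj_ball \<alpha> T r" "y \<in> traj_ball \<alpha> T r" for x y
    using that weighted_norm_diff_eq_0[of x T y \<alpha>] by (auto simp: traj_ball_def traj_dist_def)
qed (auto simp: traj_dist_def weighted_norm_diff_triangle)

text \<open>A Cauchy sequence converges at each time by completeness of the Euclidean space. The
  pointwise limit stays in the ball, and the Cauchy estimate passes to the limit, both by continuity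
  of \<open>nrm\<close>.\<close>

lemma mcomplete_traj_ball: "Metric_space.mcomplete (traj_ball \<alpha> T r) (traj_dist \<alpha> T)"
proof -
  interpret Metric_space "traj_ball \<alpha> T r" "traj_dist \<alpha> T"
    by (rule Metric_space_traj_ball)
  obtain k where k: "k > 0" "\<And>x. norm x \<le> k * nrm x"
    using norm_le_nrm by blast
  show ?thesis
    unfolding mcomplete_def
  proof (intro allI impI)
    fix \<sigma> assume "MCauchy \<sigma>"
    then have \<sigma>: "\<And>j. \<sigma> j \<in> traj_ball \<alpha> T r"
      and cauchy: "\<And>\<epsilon>. \<epsilon> > 0 \<Longrightarrow> \<exists>M. \<forall>i j. M \<le> i \<longrightarrow> M \<le> j \<longrightarrow> traj_dist \<alpha> T (\<sigma> i) (\<sigma> j) < \<epsilon>"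
      by (auto simp: MCauchy_def)
    have "Cauchy (\<lambda>j. \<sigma> j t)" if "t \<le> T" for t
    proof (rule CauchyI)
      fix \<epsilon> :: real assume "\<epsilon> > 0"
      \<comment> \<open>Passing from the weighted distance to the Euclidean norm at time
        \<open>t\<close> costs the factor \<open>k * weight \<alpha> T t\<close>, which is divided
        out in advance.\<close>
      define \<eta> where "\<eta> = \<epsilon> / (k * weight \<alpha> T t)"
      have "\<eta> > 0"
        using \<open>\<epsilon> > 0\<close> k(1) by (simp add: \<eta>_def)
      then obtain M where M: "\<And>i j. M \<le> i \<Longrightarrow> M \<le> j \<Longrightarrow> traj_dist \<alpha> T (\<sigma> i) (\<sigma> j) < \<eta>"
        using cauchy by blast
      have "norm (\<sigma> i t - \<sigma> j t) < \<epsilon>" if ij: "M \<le> i" "M \<le> j" for i j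
      proof -
        have "norm (\<sigma> i t - \<sigma> j t) \<le> k * nrm (\<sigma> i t - \<sigma> j t)"
          by (rule k)
        also have "\<dots> \<le> k * (traj_dist \<alpha> T (\<sigma> i) (\<sigma> j) * weight \<alpha> T t)"
          using weighted_norm_bound[OF \<open>t \<le> T\<close>, of nrm "\<lambda>t. \<sigma> i t - \<sigma> j t" \<alpha>] k(1)
          by (simp add: traj_dist_def)
        also have "\<dots> < k * (\<eta> * weight \<alpha> T t)"
          using M[OF ij] k(1) by simp
        also have "\<dots> = \<epsilon>"
          using k(1) by (simp add: \<eta>_def)
        finally show ?thesis .
      qed
      then show "\<exists>M. \<forall>i\<ge>M. \<forall>j\<ge>M. norm (\<sigma> i t - \<sigma> j t) < \<epsilon>"
        by blast
    qed
    then have "\<exists>l. (\<lambda>j. \<sigma> j t) \<longlonglongrightarrow> l" if "t \<le> T" for t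
      using that Cauchy_convergent_iff convergent_def by blast
    then obtain l where l: "\<And>t. t \<le> T \<Longrightarrow> (\<lambda>j. \<sigma> j t) \<longlonglongrightarrow> l t"
      by metis
    \<comment> \<open>The values of \<open>l\<close> after time \<open>T\<close> are unspecified;
      cutting them off puts the limit into \<open>traj T\<close>.\<close>
    define x where "x = (\<lambda>t. if t \<le> T then l t else 0)"
    have lim: "(\<lambda>j. \<sigma> j t) \<longlonglongrightarrow> x t" if "t \<le> T" for t
      using l that by (simp add: x_def)
    have "nrm (x t) \<le> r * weight \<alpha> T t" if "t \<le> T" for t
      using \<sigma> that
      by (intro LIMSEQ_le_const2[OF tendsto[OF lim[OF that]]])
         (auto simp: traj_ball_def weighted_norm_le_iff)
    then have xM: "x \<in> traj_ball \<alpha> T r"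
      by (auto simp: traj_ball_def traj_def weighted_norm_le_iff) (simp add: x_def)
    have "\<exists>M. \<forall>i\<ge>M. traj_dist \<alpha> T (\<sigma> i) x < \<epsilon>" if "\<epsilon> > 0" for \<epsilon>
    proof -
      obtain M where M: "\<And>i j. M \<le> i \<Longrightarrow> M \<le> j \<Longrightarrow> traj_dist \<alpha> T (\<sigma> i) (\<sigma> j) < \<epsilon> / 2"
        using cauchy[of "\<epsilon> / 2"] \<open>\<epsilon> > 0\<close> by auto
      have "traj_dist \<alpha> T (\<sigma> i) x \<le> \<epsilon> / 2" if "M \<le> i" for i
        unfolding traj_dist_def weighted_norm_le_iff
      proof safe
        fix t assume t: "t \<le> T"
        \<comment> \<open>Letting \<open>j\<close> tend to infinity replaces
          \<open>\<sigma> j t\<close> by \<open>x t\<close>. The strict bound may become an equality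
          in the limit, hence the use of \<open>\<epsilon> / 2\<close>.\<close>
        have "nrm (\<sigma> i t - \<sigma> j t) \<le> \<epsilon> / 2 * weight \<alpha> T t" if "M \<le> j" for j
          using less_imp_le[OF M[OF \<open>M \<le> i\<close> that]] t
          unfolding traj_dist_def weighted_norm_le_iff by blast
        then show "nrm (\<sigma> i t - x t) \<le> \<epsilon> / 2 * weight \<alpha> T t"
          by (intro LIMSEQ_le_const2[OF tendsto[OF tendsto_diff[OF tendsto_const lim[OF t]]]]) blast
      qed
      then show ?thesis
        using \<open>\<epsilon> > 0\<close> by (intro exI[of _ M]) fastforce
    qed
    then have "limitin mtopology \<sigma> x sequentially"
      using \<sigma> xM by (auto simp: limit_metric_sequentially)
    then show "\<exists>x. limitin mtopology \<sigma> x sequentially"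
      by blast
  qed
qed

end

section \<open>Linear boundary value problems\<close>

text \<open>A norm is nonnegative, so the bound at a single nonzero point of the neighborhood
  already fixes the sign of the constant.\<close>

lemma quadratic_bounds_const_nonneg:
  fixes nrm :: "real^'n \<Rightarrow> real"
  assumes "is_norm nrm" "open U" "(0, 0) \<in> U" "quadratic_bounds nrm U K N"
  shows "0 \<le> K"
proof -
  interpret norm_fun nrm
    by unfold_locales fact
  obtain \<epsilon> where \<epsilon>: "\<epsilon> > 0" "ball ((0, 0) :: (real^'n) \<times> (real^'n)) \<epsilon> \<subseteq> U"
    using assms(2,3) open_contains_ball by blast
  \<comment> \<open>A short vector along an arbitrary coordinate axis; any index would do.\<close>
  define x :: "real^'n" where "x = (\<epsilon> / 2) *\<^sub>R axis undefined 1"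
  have "x \<noteq> 0" "norm x < \<epsilon>"
    using \<epsilon>(1) by (auto simp: x_def axis_eq_0_iff)
  then have "(x, 0) \<in> U"
    using \<epsilon>(2) by (auto simp: dist_norm norm_Pair)
  then have "nrm (N (x, 0)) \<le> K * (nrm x + nrm 0)\<^sup>2"
    using assms(4) unfolding quadratic_bounds_def by blast
  then have "0 \<le> K * (nrm x)\<^sup>2"
    using order_trans[OF nonneg] by simp
  moreover have "0 < (nrm x)\<^sup>2"
    using \<open>x \<noteq> 0\<close> by simp
  ultimately show ?thesis
    by (simp add: zero_le_mult_iff)
qed

text \<open>At time 0 of the horizon \<open>T\<^sub>0\<close>, the boundary kernel is positive and
  is bounded by the constant times a positive square.\<close>

lemma convolution_constant_nonneg:
  assumes "convolution_constant \<gamma> \<alpha> T\<^sub>0 K"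
  shows "0 \<le> K"
proof -
  have "exp (- \<gamma> * real 0) + exp (- \<gamma> * (real T\<^sub>0 - real 0)) \<le> K * (weight \<alpha> T\<^sub>0 0)\<^sup>2"
    using assms unfolding convolution_constant_def by blast
  then have "0 \<le> K * (weight \<alpha> T\<^sub>0 0)\<^sup>2"
    by (rule order_trans[rotated]) simp
  moreover have "0 < (weight \<alpha> T\<^sub>0 0)\<^sup>2"
    by simp
  ultimately show ?thesis
    by (simp only: zero_le_mult_iff) auto
qed

text \<open>Superposition: it makes the Green bound applicable to differences of Picard images and
  to the deviation from the linear solution.\<close>

lemma linear_bvp_diff:
  assumes "linear L" "linear_bvp L B\<^sub>0 B\<^sub>T T f b h" "linear_bvp L B\<^sub>0 B\<^sub>T T g b' k"
  shows "linear_bvp L B\<^sub>0 B\<^sub>T T (\<lambda>s. f s - g s) (b - b') (\<lambda>t. h t - k t)"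
proof -
  have "L (h t - k t, h (Suc t) - k (Suc t)) = L (h t, h (Suc t)) - L (k t, k (Suc t))" for t
    using linear_diff[OF assms(1), of "(h t, h (Suc t))" "(k t, k (Suc t))"] by simp
  then show ?thesis
    using assms(2,3)
    by (simp add: linear_bvp_def traj_def matrix_vector_mult_diff_distrib)
      (metis add_diff_add)
qed

text \<open>The nonnegativity of the constants is assumed here; it is derived from the quadratic and
  convolution bounds when the locale is interpreted.\<close>

locale nonlinear_boundary_problem = norm_fun nrm
  for nrm :: "real^'n \<Rightarrow> real" +
  fixes F B L :: "(real^'n) \<times> (real^'n) \<Rightarrow> real^'n"
    and B\<^sub>0 B\<^sub>T :: "real^'n^'n"
    and U V :: "((real^'n) \<times> (real^'n)) set"
    and C\<^sub>N C\<^sub>B C\<^sub>G C_conv \<gamma> \<alpha> R :: real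
    and T\<^sub>0 :: nat
  assumes linear_L: "linear L"
    and zero_in: "(0, 0) \<in> U" "(0, 0) \<in> V"
    and C_nonneg: "0 \<le> C\<^sub>N" "0 \<le> C\<^sub>B" "0 \<le> C_conv"
    and C\<^sub>G: "1 \<le> C\<^sub>G"
    and exponents: "0 < \<alpha>" "\<alpha> < \<gamma> / 2"
    and R: "0 < R"
    and green: "uniform_green nrm L B\<^sub>0 B\<^sub>T C\<^sub>G \<gamma> T\<^sub>0"
    and conv: "convolution_constant \<gamma> \<alpha> T\<^sub>0 C_conv"
    and tube: "ball_in_tube nrm \<alpha> T\<^sub>0 R U V"
    and F_remainder: "quadratic_bounds nrm U C\<^sub>N (\<lambda>p. F p - L p)"
    and B_remainder: "quadratic_bounds nrm V C\<^sub>B (\<lambda>(x, y). B (x, y) - B\<^sub>0 *v x - B\<^sub>T *v y)"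
begin

abbreviation bvp where "bvp \<equiv> linear_bvp L B\<^sub>0 B\<^sub>T"
abbreviation wn where "wn \<equiv> weighted_norm nrm \<alpha>"
abbreviation w where "w \<equiv> weight \<alpha>"

definition rem :: "(real^'n) \<times> (real^'n) \<Rightarrow> real^'n" where
  "rem p = F p - L p"

definition bd_rem :: "(real^'n) \<times> (real^'n) \<Rightarrow> real^'n" where
  "bd_rem = (\<lambda>(x, y). B (x, y) - B\<^sub>0 *v x - B\<^sub>T *v y)"

lemma rem_zero [simp]: "rem (0, 0) = 0"
proof -
  have "nrm (rem (0, 0)) \<le> C\<^sub>N * (nrm 0 + nrm 0)\<^sup>2"
    using F_remainder zero_in unfolding quadratic_bounds_def rem_def by blast
  then have "nrm (rem (0, 0)) = 0"
    using nonneg[of "rem (0, 0)"] by simp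
  then show ?thesis
    by simp
qed

lemma bd_rem_zero [simp]: "bd_rem (0, 0) = 0"
proof -
  have "nrm (bd_rem (0, 0)) \<le> C\<^sub>B * (nrm 0 + nrm 0)\<^sup>2"
    using B_remainder zero_in unfolding quadratic_bounds_def bd_rem_def by blast
  then have "nrm (bd_rem (0, 0)) = 0"
    using nonneg[of "bd_rem (0, 0)"] by simp
  then show ?thesis
    by simp
qed

text \<open>Each of the two factors in the Lipschitz bound for the remainder contributes one
  \<open>1 + exp \<alpha>\<close> from a pair of consecutive times.\<close>

definition D :: real where
  "D = C\<^sub>N * (1 + exp \<alpha>)\<^sup>2"

definition a :: real where
  "a = 2 * C\<^sub>G * C_conv * D + 16 * C\<^sub>G * C\<^sub>B"

text \<open>Counterpart of \<open>a\<close> for estimates that keep the squared weight: the factor 2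
  disappears, and \<open>C_conv\<close> also enters the boundary term.\<close>

definition K :: real where
  "K = C\<^sub>G * C_conv * D + 16 * C\<^sub>G * C_conv * C\<^sub>B"

text \<open>Lipschitz constant of the solution map, obtained by solving x \<le>
  \<open>C\<^sub>G\<close> d + 2 a R x for x.\<close>

definition m :: real where
  "m = C\<^sub>G / (1 - 2 * a * R)"

lemma D_nonneg: "0 \<le> D" and a_nonneg: "0 \<le> a" and K_nonneg: "0 \<le> K"
  using C_nonneg C\<^sub>G by (auto simp: D_def a_def K_def)

lemma bvp_ex1: "T\<^sub>0 \<le> T \<Longrightarrow> \<exists>!h. bvp T f b h"
  using green by (auto simp: uniform_green_def)

lemma bd_solution: "T\<^sub>0 \<le> T \<Longrightarrow> bvp T (\<lambda>_. 0) b (bd_solution L B\<^sub>0 B\<^sub>T T b)"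
  unfolding bd_solution_def by (rule theI'[OF bvp_ex1])

text \<open>Forcing of size \<open>\<phi> * (w T s)\<^sup>2\<close> keeps this profile after
  convolution with the Green kernel. The boundary kernel is left as it is, because it is estimated
  later in two different ways.\<close>

lemma green_bound:
  assumes T: "T\<^sub>0 \<le> T" and h: "bvp T f b h"
    and f: "\<And>s. s < T \<Longrightarrow> nrm (f s) \<le> \<phi> * (w T s)\<^sup>2" and \<phi>: "0 \<le> \<phi>" and t: "t \<le> T"
  shows "nrm (h t) \<le> C\<^sub>G * ((exp (- \<gamma> * real t) + exp (- \<gamma> * (real T - real t))) * nrm b
    + \<phi> * C_conv * (w T t)\<^sup>2)"
proof -
  have "(\<Sum>s<T. green_kernel \<gamma> T t s * nrm (f s))
      \<le> (\<Sum>s<T. green_kernel \<gamma> T t s * (\<phi> * (w T s)\<^sup>2))"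
    using f by (intro sum_mono mult_left_mono) (auto simp: green_kernel_def)
  also have "\<dots> = \<phi> * (\<Sum>s<T. green_kernel \<gamma> T t s * (w T s)\<^sup>2)"
    by (simp add: sum_distrib_left mult_ac)
  also have "\<dots> \<le> \<phi> * (C_conv * (w T t)\<^sup>2)"
    using conv T t \<phi> by (intro mult_left_mono) (auto simp: convolution_constant_def)
  finally have sum: "(\<Sum>s<T. green_kernel \<gamma> T t s * nrm (f s)) \<le> \<phi> * C_conv * (w T t)\<^sup>2"
    by simp
  have "nrm (h t) \<le> C\<^sub>G * ((exp (- \<gamma> * real t) + exp (- \<gamma> * (real T - real t))) * nrm b
      + (\<Sum>s<T. green_kernel \<gamma> T t s * nrm (f s)))"
    using green T t h unfolding uniform_green_def by blast
  also have "\<dots> \<le> C\<^sub>G * ((exp (- \<gamma> * real t) + exp (- \<gamma> * (real T - real t))) * nrm b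
      + \<phi> * C_conv * (w T t)\<^sup>2)"
    using sum C\<^sub>G by simp
  finally show ?thesis .
qed

lemma boundary_kernel_le_weight:
  assumes "t \<le> T"
  shows "exp (- \<gamma> * real t) + exp (- \<gamma> * (real T - real t)) \<le> w T t"
proof -
  have "\<alpha> \<le> \<gamma>"
    using exponents by simp
  then have "\<alpha> * real t \<le> \<gamma> * real t" "\<alpha> * (real T - real t) \<le> \<gamma> * (real T - real t)"
    using assms by (auto intro: mult_right_mono)
  then show ?thesis
    unfolding weight_def by (intro add_mono) auto
qed

lemma boundary_kernel_le_weight_square:
  assumes "T\<^sub>0 \<le> T" "t \<le> T"
  shows "exp (- \<gamma> * real t) + exp (- \<gamma> * (real T - real t)) \<le> C_conv * (w T t)\<^sup>2"
  using conv assms unfolding convolution_constant_def by blast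

section \<open>The Picard map\<close>

lemma consecutive_bound:
  assumes "s < T"
  shows "nrm (z s) + nrm (z (Suc s)) \<le> wn T z * ((1 + exp \<alpha>) * w T s)"
proof -
  have "nrm (z s) + nrm (z (Suc s)) \<le> wn T z * w T s + wn T z * w T (Suc s)"
    using assms by (intro add_mono weighted_norm_bound) auto
  also have "\<dots> \<le> wn T z * w T s + wn T z * (exp \<alpha> * w T s)"
    using exponents by (intro add_left_mono mult_left_mono weight_Suc_le) auto
  finally show ?thesis
    by (simp add: algebra_simps)
qed

text \<open>The weight is at most 2 at either end, so the two ends together give 4; the product of
  two such bounds is the 16 in \<open>a\<close> and \<open>K\<close>.\<close>

lemma endpoint_bound: "nrm (z 0) + nrm (z T) \<le> 4 * wn T z"
proof -
  have "nrm (z t) \<le> wn T z * 2" if "t \<le> T" for t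
    using weighted_norm_bound[OF that, of nrm z \<alpha>]
      mult_left_mono[OF weight_le_2[OF _ that, of \<alpha>] weighted_norm_nonneg[of \<alpha> T z]] exponents
    by simp
  from this[of 0] this[of T] show ?thesis
    by simp
qed

text \<open>A relation instead of a function, so that solutions, errors and the zero trajectory can
  all enter the difference estimates directly; it is single-valued for
  \<open>T\<^sub>0 \<le> T\<close>.\<close>

definition picard_step :: "nat \<Rightarrow> real^'n \<Rightarrow> (nat \<Rightarrow> real^'n) \<Rightarrow> (nat \<Rightarrow> real^'n) \<Rightarrow> bool" where
  "picard_step T \<Delta> z h \<longleftrightarrow> bvp T (\<lambda>s. - rem (z s, z (Suc s))) (\<Delta> - bd_rem (z 0, z T)) h"

lemma nonlinear_bvp_iff: "nonlinear_bvp F B T \<Delta> z \<longleftrightarrow> picard_step T \<Delta> z z"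
  by (auto simp: picard_step_def nonlinear_bvp_def linear_bvp_def rem_def bd_rem_def algebra_simps)

text \<open>Comparison with the zero trajectory turns every difference estimate into a bound on a
  single trajectory.\<close>

lemma picard_step_zero: "picard_step T 0 (\<lambda>_. 0) (\<lambda>_. 0)"
  using linear_0[OF linear_L] by (simp add: picard_step_def linear_bvp_def traj_def zero_prod_def)

text \<open>Subtracting the linear solution removes the datum and leaves only the remainders as
  sources, so errors for different data become Picard images with the same datum 0.\<close>

lemma picard_step_error:
  assumes "T\<^sub>0 \<le> T" "picard_step T \<Delta> z h"
  shows "picard_step T 0 z (\<lambda>t. h t - bd_solution L B\<^sub>0 B\<^sub>T T \<Delta> t)"
  using linear_bvp_diff[OF linear_L assms(2)[unfolded picard_step_def] bd_solution[OF assms(1), of \<Delta>]]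
  by (simp add: picard_step_def)

section \<open>Differences of two Picard images\<close>

context
  fixes T :: nat and z y :: "nat \<Rightarrow> real^'n"
  assumes T: "T\<^sub>0 \<le> T"
    and z: "z \<in> traj T" "wn T z \<le> R"
    and y: "y \<in> traj T" "wn T y \<le> R"
begin

text \<open>The quadratic Lipschitz bounds turn each difference of remainders into a multiple of
  this quantity.\<close>

abbreviation (input) q :: real where
  "q \<equiv> (wn T z + wn T y) * wn T (\<lambda>t. z t - y t)"

lemma q_nonneg: "0 \<le> q"
  by simp

text \<open>The tube condition places the pairs in \<open>U\<close>. The sum of sizes and the sum of
  differences each carry one weight, whence the square.\<close>

lemma rem_diff:
  assumes s: "s < T"
  shows "nrm (rem (z s, z (Suc s)) - rem (y s, y (Suc s))) \<le> D * q * (w T s)\<^sup>2"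
proof -
  let ?v = "(1 + exp \<alpha>) * w T s"
  have "(z s, z (Suc s)) \<in> U" "(y s, y (Suc s)) \<in> U"
    using tube T z y s by (auto simp: ball_in_tube_def)
  then have "nrm (rem (z s, z (Suc s)) - rem (y s, y (Suc s)))
      \<le> C\<^sub>N * (nrm (z s) + nrm (z (Suc s)) + nrm (y s) + nrm (y (Suc s)))
        * (nrm (z s - y s) + nrm (z (Suc s) - y (Suc s)))"
    using F_remainder unfolding quadratic_bounds_def rem_def by blast
  also have "\<dots> \<le> C\<^sub>N * ((wn T z + wn T y) * ?v) * (wn T (\<lambda>t. z t - y t) * ?v)"
    using consecutive_bound[OF s, of z] consecutive_bound[OF s, of y]
      consecutive_bound[OF s, of "\<lambda>t. z t - y t"] C_nonneg
    by (intro mult_mono mult_left_mono) (auto simp: distrib_right add_nonneg_nonneg)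
  also have "\<dots> = D * q * (w T s)\<^sup>2"
    by (simp add: D_def power2_eq_square)
  finally show ?thesis .
qed

lemma bd_rem_diff: "nrm (bd_rem (z 0, z T) - bd_rem (y 0, y T)) \<le> 16 * C\<^sub>B * q"
proof -
  have "(z 0, z T) \<in> V" "(y 0, y T) \<in> V"
    using tube T z y by (auto simp: ball_in_tube_def)
  then have "nrm (bd_rem (z 0, z T) - bd_rem (y 0, y T))
      \<le> C\<^sub>B * (nrm (z 0) + nrm (z T) + nrm (y 0) + nrm (y T))
        * (nrm (z 0 - y 0) + nrm (z T - y T))"
    using B_remainder unfolding quadratic_bounds_def bd_rem_def by blast
  also have "\<dots> \<le> C\<^sub>B * (4 * (wn T z + wn T y)) * (4 * wn T (\<lambda>t. z t - y t))"
    using endpoint_bound[of z T] endpoint_bound[of y T]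
      endpoint_bound[of "\<lambda>t. z t - y t" T] C_nonneg
    by (intro mult_mono mult_left_mono) (auto simp: add_nonneg_nonneg)
  finally show ?thesis
    by (simp add: algebra_simps)
qed

context
  fixes \<Delta> \<Delta>' :: "real^'n" and h k :: "nat \<Rightarrow> real^'n"
  assumes h: "picard_step T \<Delta> z h" and k: "picard_step T \<Delta>' y k"
begin

lemma picard_step_diff:
  assumes t: "t \<le> T"
  shows "nrm (h t - k t) \<le> C\<^sub>G * ((exp (- \<gamma> * real t) + exp (- \<gamma> * (real T - real t)))
    * (nrm (\<Delta> - \<Delta>') + 16 * C\<^sub>B * q) + D * q * C_conv * (w T t)\<^sup>2)"
proof -
  let ?b = "(\<Delta> - bd_rem (z 0, z T)) - (\<Delta>' - bd_rem (y 0, y T))"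
  have "nrm (h t - k t) \<le> C\<^sub>G * ((exp (- \<gamma> * real t) + exp (- \<gamma> * (real T - real t))) * nrm ?b
      + D * q * C_conv * (w T t)\<^sup>2)"
  proof (rule green_bound[OF T linear_bvp_diff[OF linear_L] _ _ t])
    show "bvp T (\<lambda>s. - rem (z s, z (Suc s))) (\<Delta> - bd_rem (z 0, z T)) h"
      and "bvp T (\<lambda>s. - rem (y s, y (Suc s))) (\<Delta>' - bd_rem (y 0, y T)) k"
      using h k by (auto simp: picard_step_def)
    show "nrm (- rem (z s, z (Suc s)) - - rem (y s, y (Suc s))) \<le> D * q * (w T s)\<^sup>2"
      if "s < T" for s
      using rem_diff[OF that] minus[of "rem (z s, z (Suc s)) - rem (y s, y (Suc s))"] by simp
    show "0 \<le> D * q"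
      using D_nonneg q_nonneg by simp
  qed
  also have "nrm ?b \<le> nrm (\<Delta> - \<Delta>') + 16 * C\<^sub>B * q"
    using triangle_sub[of "\<Delta> - \<Delta>'" "bd_rem (z 0, z T) - bd_rem (y 0, y T)"] bd_rem_diff
    by (simp add: algebra_simps)
  finally show ?thesis
    using C\<^sub>G by (simp add: mult_left_mono)
qed

text \<open>Here the boundary kernel is bounded by the weight and the squared weight by twice the
  weight, which leaves the single factor that the weighted norm divides out.\<close>

lemma picard_step_lipschitz:
  "wn T (\<lambda>t. h t - k t) \<le> C\<^sub>G * nrm (\<Delta> - \<Delta>') + a * q"
  unfolding weighted_norm_le_iff
proof safe
  fix t assume t: "t \<le> T"
  let ?\<beta> = "nrm (\<Delta> - \<Delta>') + 16 * C\<^sub>B * q"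
  have "nrm (h t - k t) \<le> C\<^sub>G * ((exp (- \<gamma> * real t) + exp (- \<gamma> * (real T - real t))) * ?\<beta>
      + D * q * C_conv * (w T t)\<^sup>2)"
    by (rule picard_step_diff[OF t])
  also have "\<dots> \<le> C\<^sub>G * (w T t * ?\<beta> + D * q * C_conv * (2 * w T t))"
    using boundary_kernel_le_weight[OF t] weight_square_le[OF less_imp_le[OF exponents(1)] t]
      C_nonneg C\<^sub>G D_nonneg q_nonneg
    by (intro mult_left_mono add_mono mult_right_mono) auto
  also have "\<dots> = (C\<^sub>G * nrm (\<Delta> - \<Delta>') + a * q) * w T t"
    by (simp add: a_def algebra_simps)
  finally show "nrm (h t - k t) \<le> (C\<^sub>G * nrm (\<Delta> - \<Delta>') + a * q) * w T t" .
qed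

text \<open>With equal data only terms proportional to \<open>q\<close> remain; bounding the
  boundary kernel by \<open>C_conv\<close> times the squared weight preserves the full decay in all
  of them.\<close>

lemma picard_step_fine:
  assumes "\<Delta> = \<Delta>'" and t: "t \<le> T"
  shows "nrm (h t - k t) \<le> K * q * (w T t)\<^sup>2"
proof -
  have "nrm (h t - k t) \<le> C\<^sub>G * ((exp (- \<gamma> * real t) + exp (- \<gamma> * (real T - real t)))
      * (16 * C\<^sub>B * q) + D * q * C_conv * (w T t)\<^sup>2)"
    using picard_step_diff[OF t] assms(1) by simp
  also have "\<dots> \<le> C\<^sub>G * (C_conv * (w T t)\<^sup>2 * (16 * C\<^sub>B * q) + D * q * C_conv * (w T t)\<^sup>2)"
    using boundary_kernel_le_weight_square[OF T t] C_nonneg C\<^sub>G q_nonneg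
    by (intro mult_left_mono add_mono mult_right_mono) auto
  also have "\<dots> = K * q * (w T t)\<^sup>2"
    by (simp add: K_def algebra_simps)
  finally show ?thesis .
qed

end

end

end

section \<open>Small solutions of the nonlinear problem\<close>

text \<open>For positive a, multiplying c d < R - a R^2 by 4 a and completing the square gives (1 -
  2 a R)^2 < 1 - 4 a c d. The discriminant is therefore positive, and its root exceeds 1 - 2 a R,
  which places the smaller root of the quadratic left of R.\<close>

lemma R_minus_fixed_point:
  fixes a c d R :: real
  assumes "0 \<le> a" "0 \<le> c * d" "0 < R" "2 * a * R < 1" "c * d < R - a * R\<^sup>2"
  shows "0 \<le> R_minus a c d" "R_minus a c d < R" "c * d + a * (R_minus a c d)\<^sup>2 = R_minus a c d"
proof -
  let ?r = "R_minus a c d"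
  have "0 \<le> ?r \<and> ?r < R \<and> c * d + a * ?r\<^sup>2 = ?r"
  proof (cases "a = 0")
    case True
    then show ?thesis
      using assms by (simp add: R_minus_def)
  next
    case False
    then have a: "0 < a"
      using assms by simp
    define \<rho> where "\<rho> = sqrt (1 - 4 * a * c * d)"
    have "4 * a * (c * d) < 4 * a * (R - a * R\<^sup>2)"
      using a assms(5) by simp
    then have lower: "(1 - 2 * a * R)\<^sup>2 < 1 - 4 * a * c * d"
      by (simp add: power2_eq_square algebra_simps)
    then have "1 - 2 * a * R < \<rho>"
      unfolding \<rho>_def by (rule real_less_rsqrt)
    moreover have "\<rho> \<le> 1"
      using mult_nonneg_nonneg[OF less_imp_le[OF a] assms(2)] by (simp add: \<rho>_def mult.assoc)
    moreover have "\<rho>\<^sup>2 = 1 - 4 * a * c * d"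
      unfolding \<rho>_def using le_less_trans[OF zero_le_power2 lower] by simp
    moreover have "\<rho> = 1 - 2 * a * ?r"
      using False by (simp add: R_minus_def \<rho>_def)
    \<comment> \<open>The three claims are first obtained multiplied by \<open>a\<close>, where they
      are relations in \<open>\<rho>\<close>; then the positive factor is cancelled.\<close>
    ultimately have "0 \<le> a * ?r" "a * ?r < a * R" "a * (c * d + a * ?r\<^sup>2) = a * ?r"
      by (simp_all add: power2_eq_square algebra_simps)
    then show ?thesis
      using a by (simp add: zero_le_mult_iff)
  qed
  then show "0 \<le> ?r" "?r < R" "c * d + a * ?r\<^sup>2 = ?r"
    by auto
qed

context nonlinear_boundary_problem
begin

context
  assumes small: "2 * a * R < 1"
begin

lemma coefficient_bound:
  assumes "wn T z \<le> R" "wn T y \<le> R" "0 \<le> x"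
  shows "a * ((wn T z + wn T y) * x) \<le> 2 * a * R * x"
proof -
  have "(wn T z + wn T y) * x \<le> (R + R) * x"
    using assms by (intro mult_right_mono add_mono) auto
  then show ?thesis
    using mult_left_mono[OF _ a_nonneg] by fastforce
qed

text \<open>Both solutions are fixed points, so the same difference stands on both sides of the
  Picard estimate, and its coefficient \<open>2 * a * R\<close> < 1 can be absorbed. Equal data give
  uniqueness.\<close>

lemma solution_lipschitz:
  assumes T: "T\<^sub>0 \<le> T"
    and z: "nonlinear_bvp F B T \<Delta> z" "wn T z \<le> R"
    and y: "nonlinear_bvp F B T \<Delta>' y" "wn T y \<le> R"
  shows "wn T (\<lambda>t. z t - y t) \<le> m * nrm (\<Delta> - \<Delta>')"
proof -
  have tr: "z \<in> traj T" "y \<in> traj T"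
    using z y by (auto simp: nonlinear_bvp_def)
  have "wn T (\<lambda>t. z t - y t)
      \<le> C\<^sub>G * nrm (\<Delta> - \<Delta>') + a * ((wn T z + wn T y) * wn T (\<lambda>t. z t - y t))"
    using T tr z y by (intro picard_step_lipschitz) (auto simp: nonlinear_bvp_iff)
  also have "\<dots> \<le> C\<^sub>G * nrm (\<Delta> - \<Delta>') + 2 * a * R * wn T (\<lambda>t. z t - y t)"
    using coefficient_bound[OF z(2) y(2)] by simp
  finally show ?thesis
    using small by (simp add: m_def field_simps)
qed

lemma solution_unique:
  assumes "T\<^sub>0 \<le> T" "nonlinear_bvp F B T \<Delta> z" "wn T z \<le> R"
    and "nonlinear_bvp F B T \<Delta> y" "wn T y \<le> R"
  shows "z = y"
  using solution_lipschitz[OF assms] assms(2,4)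
  by (intro weighted_norm_diff_eq_0[of z T y \<alpha>]) (auto simp: nonlinear_bvp_def)

lemma solution_exists:
  assumes T: "T\<^sub>0 \<le> T" and \<Delta>: "C\<^sub>G * nrm \<Delta> < R - a * R\<^sup>2"
  obtains z where "nonlinear_bvp F B T \<Delta> z" "wn T z \<le> R_minus a C\<^sub>G (nrm \<Delta>)"
proof -
  define r where "r = R_minus a C\<^sub>G (nrm \<Delta>)"
  have r: "0 \<le> r" "r < R" "C\<^sub>G * nrm \<Delta> + a * r\<^sup>2 = r"
    unfolding r_def by (rule R_minus_fixed_point; use a_nonneg C\<^sub>G R small \<Delta> in simp)+
  define \<Phi> where "\<Phi> = (\<lambda>z. THE h. picard_step T \<Delta> z h)"
  have \<Phi>: "picard_step T \<Delta> z (\<Phi> z)" for z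
    unfolding \<Phi>_def picard_step_def by (rule theI'[OF bvp_ex1[OF T]])
  interpret Metric_space "traj_ball \<alpha> T r" "traj_dist \<alpha> T"
    by (rule Metric_space_traj_ball)
  have in_ball: "z \<in> traj T" "wn T z \<le> R" "wn T z \<le> r" if "z \<in> traj_ball \<alpha> T r" for z
    using that r(2) by (auto simp: traj_ball_def)
  obtain z where "z \<in> traj_ball \<alpha> T r" "\<Phi> z = z"
  \<comment> \<open>The ball of radius \<open>r\<close> lies in the ball of radius \<open>R\<close>,
    so the contraction factor \<open>2 * a * R\<close> applies on it.\<close>
  proof (rule Banach_fixedpoint_thm[OF mcomplete_traj_ball _ _ small])
    show "traj_ball \<alpha> T r \<noteq> {}"
      using r(1) by (auto simp: traj_ball_def traj_def intro!: exI[of _ "\<lambda>_. 0"])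
    show "\<Phi> \<in> traj_ball \<alpha> T r \<rightarrow> traj_ball \<alpha> T r"
    proof
      fix z assume z: "z \<in> traj_ball \<alpha> T r"
      \<comment> \<open>Comparing with the zero trajectory gives the bound
        \<open>C\<^sub>G * nrm \<Delta> + a * (wn T z)\<^sup>2\<close>, and the quadratic equation
        for \<open>r\<close> turns it into invariance.\<close>
      have "wn T (\<lambda>t. \<Phi> z t - 0)
          \<le> C\<^sub>G * nrm (\<Delta> - 0) + a * ((wn T z + wn T (\<lambda>_. 0)) * wn T (\<lambda>t. z t - 0))"
        using T in_ball[OF z] \<Phi> picard_step_zero R
        by (intro picard_step_lipschitz) (auto simp: traj_def)
      then have "wn T (\<Phi> z) \<le> C\<^sub>G * nrm \<Delta> + a * (wn T z)\<^sup>2"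
        by (simp add: power2_eq_square)
      also have "\<dots> \<le> r"
        using r(3) in_ball[OF z] a_nonneg
          mult_left_mono[OF power_mono[of "wn T z" r 2] a_nonneg] by simp
      finally show "\<Phi> z \<in> traj_ball \<alpha> T r"
        using \<Phi>[of z] by (auto simp: traj_ball_def picard_step_def linear_bvp_def)
    qed
    fix z y assume zy: "z \<in> traj_ball \<alpha> T r" "y \<in> traj_ball \<alpha> T r"
    have "wn T (\<lambda>t. \<Phi> z t - \<Phi> y t)
        \<le> C\<^sub>G * nrm (\<Delta> - \<Delta>) + a * ((wn T z + wn T y) * wn T (\<lambda>t. z t - y t))"
      using T in_ball[OF zy(1)] in_ball[OF zy(2)] \<Phi> by (intro picard_step_lipschitz) auto
    also have "\<dots> \<le> 2 * a * R * wn T (\<lambda>t. z t - y t)"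
      using coefficient_bound[OF in_ball(2)[OF zy(1)] in_ball(2)[OF zy(2)]] by simp
    finally show "traj_dist \<alpha> T (\<Phi> z) (\<Phi> y) \<le> 2 * a * R * traj_dist \<alpha> T z y"
      by (simp add: traj_dist_def)
  qed auto
  then show thesis
    using that[of z] \<Phi>[of z] in_ball(3)[of z] by (simp add: nonlinear_bvp_iff r_def)
qed

section \<open>Deviation from the linear solution and differentiability at 0\<close>

lemma m_nonneg: "0 \<le> m"
  using small C\<^sub>G by (simp add: m_def)

lemma solution_bound:
  assumes T: "T\<^sub>0 \<le> T" and z: "nonlinear_bvp F B T \<Delta> z" "wn T z \<le> R"
  shows "wn T z \<le> m * nrm \<Delta>"
  using solution_lipschitz[OF T z, of 0 "\<lambda>_. 0"] picard_step_zero[of T] R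
  by (simp add: nonlinear_bvp_iff)

text \<open>The errors are Picard images of \<open>z\<close> and \<open>y\<close> with the common
  datum 0, so the fine estimate applies. Bounding the sizes and the difference of the solutions by
  \<open>m\<close> times their data yields the factor \<open>m\<^sup>2\<close>.\<close>

lemma error_lipschitz:
  assumes T: "T\<^sub>0 \<le> T" and t: "t \<le> T"
    and z: "nonlinear_bvp F B T \<Delta> z" "wn T z \<le> R"
    and y: "nonlinear_bvp F B T \<Delta>' y" "wn T y \<le> R"
  shows "nrm ((z t - bd_solution L B\<^sub>0 B\<^sub>T T \<Delta> t) - (y t - bd_solution L B\<^sub>0 B\<^sub>T T \<Delta>' t))
    \<le> K * m\<^sup>2 * (w T t)\<^sup>2 * (nrm \<Delta> + nrm \<Delta>') * nrm (\<Delta> - \<Delta>')"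
proof -
  have tr: "z \<in> traj T" "y \<in> traj T"
    using z y by (auto simp: nonlinear_bvp_def)
  have "nrm ((z t - bd_solution L B\<^sub>0 B\<^sub>T T \<Delta> t) - (y t - bd_solution L B\<^sub>0 B\<^sub>T T \<Delta>' t))
      \<le> K * ((wn T z + wn T y) * wn T (\<lambda>t. z t - y t)) * (w T t)\<^sup>2"
    using picard_step_fine[OF T tr(1) z(2) tr(2) y(2) picard_step_error[OF T] picard_step_error[OF T]
        refl t] z(1) y(1)
    by (simp add: nonlinear_bvp_iff)
  also have "\<dots> \<le> K * ((m * nrm \<Delta> + m * nrm \<Delta>') * (m * nrm (\<Delta> - \<Delta>'))) * (w T t)\<^sup>2"
    using solution_bound[OF T z] solution_bound[OF T y] solution_lipschitz[OF T z y]
      K_nonneg m_nonneg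
    by (intro mult_right_mono mult_left_mono mult_mono add_mono)
      (auto intro!: add_nonneg_nonneg mult_nonneg_nonneg)
  finally show ?thesis
    by (simp add: power2_eq_square algebra_simps)
qed

text \<open>Comparison with datum 0, for which the solution and its linear part both vanish.\<close>

lemma error_bound:
  assumes T: "T\<^sub>0 \<le> T" and t: "t \<le> T" and z: "nonlinear_bvp F B T \<Delta> z" "wn T z \<le> R"
  shows "nrm (z t - bd_solution L B\<^sub>0 B\<^sub>T T \<Delta> t) \<le> K * m\<^sup>2 * (w T t)\<^sup>2 * (nrm \<Delta>)\<^sup>2"
proof -
  have "bvp T (\<lambda>_. 0) 0 (\<lambda>_. 0)"
    using picard_step_zero[of T] by (simp add: picard_step_def)
  then have "bd_solution L B\<^sub>0 B\<^sub>T T 0 = (\<lambda>_. 0)"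
    using bvp_ex1[OF T] bd_solution[OF T] by blast
  then show ?thesis
    using error_lipschitz[OF T t z, of 0 "\<lambda>_. 0"] picard_step_zero[of T] R
    by (simp add: nonlinear_bvp_iff power2_eq_square mult_ac)
qed

text \<open>Lowering the squared weight to twice the weight bounds the weighted error by
  \<open>2 * K * m\<^sup>2 * (nrm \<Delta>)\<^sup>2\<close>. The smallness required of the datum
  does not involve \<open>T\<close>, so the bound survives the supremum.\<close>

lemma solution_family_frechet:
  assumes sol: "\<And>T \<Delta>. T\<^sub>0 \<le> T \<Longrightarrow> nrm \<Delta> < \<delta> \<Longrightarrow>
      nonlinear_bvp F B T \<Delta> (z T \<Delta>) \<and> wn T (z T \<Delta>) \<le> R"
    and \<delta>: "0 < \<delta>"
  shows "uniform_frechet_at_0 nrm \<alpha> T\<^sub>0 z (bd_solution L B\<^sub>0 B\<^sub>T)"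
  unfolding uniform_frechet_at_0_def
proof (intro allI impI)
  fix \<epsilon> :: real assume "0 < \<epsilon>"
  let ?M = "2 * (K * m\<^sup>2)"
  have lim: "(nrm \<longlongrightarrow> 0) (nhds 0)"
    using tendsto[OF filterlim_ident, of 0] by simp
  then have "((\<lambda>\<Delta>. ?M * nrm \<Delta>) \<longlongrightarrow> ?M * 0) (nhds 0)"
    by (intro tendsto_mult tendsto_const)
  then have "\<forall>\<^sub>F \<Delta> in nhds 0. ?M * nrm \<Delta> < \<epsilon>"
    using \<open>0 < \<epsilon>\<close> order_tendstoD(2) by fastforce
  then show "\<forall>\<^sub>F \<Delta> in nhds 0. (SUP T\<in>{T\<^sub>0..}.
      ereal (wn T (\<lambda>t. z T \<Delta> t - bd_solution L B\<^sub>0 B\<^sub>T T \<Delta> t))) \<le> ereal (\<epsilon> * nrm \<Delta>)"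
    using order_tendstoD(2)[OF lim \<delta>]
  proof eventually_elim
    case (elim \<Delta>)
    have "wn T (\<lambda>t. z T \<Delta> t - bd_solution L B\<^sub>0 B\<^sub>T T \<Delta> t) \<le> \<epsilon> * nrm \<Delta>" if T: "T\<^sub>0 \<le> T" for T
      unfolding weighted_norm_le_iff
    proof safe
      fix t assume t: "t \<le> T"
      have "nrm (z T \<Delta> t - bd_solution L B\<^sub>0 B\<^sub>T T \<Delta> t) \<le> K * m\<^sup>2 * (w T t)\<^sup>2 * (nrm \<Delta>)\<^sup>2"
        using sol[OF T elim(2)] by (intro error_bound T t) auto
      also have "\<dots> \<le> K * m\<^sup>2 * (2 * w T t) * (nrm \<Delta>)\<^sup>2"
        using K_nonneg weight_square_le[OF less_imp_le[OF exponents(1)] t]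
        by (intro mult_right_mono mult_left_mono) auto
      also have "\<dots> = (?M * nrm \<Delta>) * (nrm \<Delta> * w T t)"
        by (simp add: power2_eq_square)
      also have "\<dots> \<le> \<epsilon> * (nrm \<Delta> * w T t)"
        using elim(1) by (intro mult_right_mono) auto
      finally show "nrm (z T \<Delta> t - bd_solution L B\<^sub>0 B\<^sub>T T \<Delta> t) \<le> \<epsilon> * nrm \<Delta> * w T t"
        by simp
    qed
    then show ?case
      by (intro SUP_least) simp
  qed
qed

end

end

section \<open>Choice of the solution family and of one constant for all estimates\<close>

theorem theorem4p1:
  fixes nrm :: "real^'n \<Rightarrow> real"
    and F B L :: "(real^'n) \<times> (real^'n) \<Rightarrow> real^'n"
    and B\<^sub>0 B\<^sub>T :: "real^'n^'n"
    and U V :: "((real^'n) \<times> (real^'n)) set"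
    and C\<^sub>N C\<^sub>B C\<^sub>G C_conv \<gamma> \<alpha> a c R \<delta> :: real
    and T\<^sub>0 :: nat
  assumes "is_norm nrm"
    and "open U" "convex U" "(0, 0) \<in> U"
    and "C2_on U F" "F (0, 0) = 0" "(F has_derivative L) (at (0, 0))"
    and "quadratic_bounds nrm U C\<^sub>N (\<lambda>p. F p - L p)"
    and "C\<^sub>G \<ge> 1" "\<gamma> > 0" "T\<^sub>0 \<ge> 1"
    and "uniform_green nrm L B\<^sub>0 B\<^sub>T C\<^sub>G \<gamma> T\<^sub>0"
    and "0 < \<alpha>" "\<alpha> < \<gamma> / 2"
    and "convolution_constant \<gamma> \<alpha> T\<^sub>0 C_conv"
    and "open V" "convex V" "(0, 0) \<in> V"
    and "C2_bounded_on V B" "B (0, 0) = 0"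
    and "(B has_derivative (\<lambda>(x, y). B\<^sub>0 *v x + B\<^sub>T *v y)) (at (0, 0))"
    and "quadratic_bounds nrm V C\<^sub>B (\<lambda>(x, y). B (x, y) - B\<^sub>0 *v x - B\<^sub>T *v y)"
    and "c = C\<^sub>G"
    and "a = 2 * C\<^sub>G * C_conv * C\<^sub>N * (1 + exp \<alpha>)\<^sup>2 + 16 * C\<^sub>G * C\<^sub>B"
    and "R > 0" "ball_in_tube nrm \<alpha> T\<^sub>0 R U V" "2 * a * R < 1"
    and "\<delta> = (R - a * R\<^sup>2) / c"
  shows "\<exists>z :: nat \<Rightarrow> real^'n \<Rightarrow> nat \<Rightarrow> real^'n.
     (\<forall>T\<ge>T\<^sub>0. \<forall>\<Delta>. nrm \<Delta> < \<delta> \<longrightarrow>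
        nonlinear_bvp F B T \<Delta> (z T \<Delta>) \<and>
        weighted_norm nrm \<alpha> T (z T \<Delta>) \<le> R_minus a c (nrm \<Delta>) \<and>
        R_minus a c (nrm \<Delta>) < R \<and>
        (\<forall>y. nonlinear_bvp F B T \<Delta> y \<and> weighted_norm nrm \<alpha> T y \<le> R \<longrightarrow> y = z T \<Delta>)) \<and>
     (let E = (\<lambda>T \<Delta> t. z T \<Delta> t - bd_solution L B\<^sub>0 B\<^sub>T T \<Delta> t) in
      \<exists>C. \<forall>T\<ge>T\<^sub>0. \<forall>t\<le>T.
        (\<forall>\<Delta>. nrm \<Delta> < \<delta> \<longrightarrow>
           nrm (z T \<Delta> t) \<le> C * weight \<alpha> T t * nrm \<Delta> + C * (weight \<alpha> T t)\<^sup>2 * (nrm \<Delta>)\<^sup>2 \<and>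
           nrm (E T \<Delta> t) \<le> C * (weight \<alpha> T t)\<^sup>2 * (nrm \<Delta>)\<^sup>2) \<and>
        (\<forall>\<Delta>\<^sub>1 \<Delta>\<^sub>2. nrm \<Delta>\<^sub>1 < \<delta> \<longrightarrow> nrm \<Delta>\<^sub>2 < \<delta> \<longrightarrow>
           nrm (z T \<Delta>\<^sub>1 t - z T \<Delta>\<^sub>2 t) \<le> C * weight \<alpha> T t * nrm (\<Delta>\<^sub>1 - \<Delta>\<^sub>2) \<and>
           nrm (E T \<Delta>\<^sub>1 t - E T \<Delta>\<^sub>2 t)
             \<le> C * (weight \<alpha> T t)\<^sup>2 * (nrm \<Delta>\<^sub>1 + nrm \<Delta>\<^sub>2) * nrm (\<Delta>\<^sub>1 - \<Delta>\<^sub>2))) \<and>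
     uniform_frechet_at_0 nrm \<alpha> T\<^sub>0 z (bd_solution L B\<^sub>0 B\<^sub>T)"
proof -
  have a_eq: "a = 2 * C\<^sub>G * C_conv * (C\<^sub>N * (1 + exp \<alpha>)\<^sup>2) + 16 * C\<^sub>G * C\<^sub>B"
    using assms by simp
  interpret P: nonlinear_boundary_problem nrm F B L B\<^sub>0 B\<^sub>T U V C\<^sub>N C\<^sub>B C\<^sub>G C_conv \<gamma> \<alpha> R T\<^sub>0
  proof (intro nonlinear_boundary_problem.intro norm_fun.intro
      nonlinear_boundary_problem_axioms.intro)
    show "linear L"
      using assms has_derivative_linear by blast
    show "0 \<le> C\<^sub>N" "0 \<le> C\<^sub>B"
      using assms quadratic_bounds_const_nonneg by blast+
    show "0 \<le> C_conv"
      using assms convolution_constant_nonneg by blast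
  qed (use assms in auto)
  have a: "a = P.a"
    by (simp add: a_eq P.a_def P.D_def)
  have small: "2 * P.a * R < 1"
    using assms a by simp
  let ?m = "P.m"
  \<comment> \<open>A sum of nonnegative terms that dominates both the Lipschitz constant of the
    solutions and that of the errors.\<close>
  define C where "C = ?m + P.K * ?m\<^sup>2"
  have m: "0 \<le> ?m" "0 \<le> P.K * ?m\<^sup>2"
    using P.m_nonneg[OF small] P.K_nonneg by auto
  \<comment> \<open>The family must be total; its values matter only for
    \<open>T\<^sub>0 \<le> T\<close> and \<open>nrm \<Delta> < \<delta>\<close>, where a small
    solution exists.\<close>
  define z where "z = (\<lambda>T \<Delta>. SOME y. nonlinear_bvp F B T \<Delta> y \<and>
    weighted_norm nrm \<alpha> T y \<le> R_minus a c (nrm \<Delta>))"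
  have small_data: "C\<^sub>G * nrm \<Delta> < R - P.a * R\<^sup>2" if "nrm \<Delta> < \<delta>" for \<Delta>
    using that assms(9,23,28) a by (simp add: field_simps)
  have R_minus: "R_minus a c (nrm \<Delta>) < R" if "nrm \<Delta> < \<delta>" for \<Delta>
    using R_minus_fixed_point(2)[of P.a C\<^sub>G "nrm \<Delta>" R] small_data[OF that] small a assms(9,23,25)
      P.a_nonneg by simp
  have z: "nonlinear_bvp F B T \<Delta> (z T \<Delta>)"
    "weighted_norm nrm \<alpha> T (z T \<Delta>) \<le> R_minus a c (nrm \<Delta>)"
    "weighted_norm nrm \<alpha> T (z T \<Delta>) \<le> R" if "T\<^sub>0 \<le> T" "nrm \<Delta> < \<delta>" for T \<Delta>
  proof -
    have "\<exists>y. nonlinear_bvp F B T \<Delta> y \<and> weighted_norm nrm \<alpha> T y \<le> R_minus a c (nrm \<Delta>)"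
      using P.solution_exists[OF small that(1) small_data[OF that(2)]] a assms(23) by metis
    then show "nonlinear_bvp F B T \<Delta> (z T \<Delta>)"
      and *: "weighted_norm nrm \<alpha> T (z T \<Delta>) \<le> R_minus a c (nrm \<Delta>)"
      using someI_ex unfolding z_def by (metis (no_types, lifting))+
    show "weighted_norm nrm \<alpha> T (z T \<Delta>) \<le> R"
      using * R_minus[OF that(2)] by simp
  qed
  \<comment> \<open>Positivity of \<open>\<delta>\<close> makes the admissible data a neighborhood
    of 0, as differentiability there requires.\<close>
  have "0 < R * (1 - a * R)"
    using assms(25,27) by (intro mult_pos_pos) auto
  then have \<delta>: "0 < \<delta>"
    using assms(9,23,28) by (simp add: algebra_simps power2_eq_square)
  have single: "nrm (z T \<Delta> t) \<le> C * weight \<alpha> T t * nrm \<Delta> + C * (weight \<alpha> T t)\<^sup>2 * (nrm \<Delta>)\<^sup>2 \<and>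
      nrm (z T \<Delta> t - bd_solution L B\<^sub>0 B\<^sub>T T \<Delta> t) \<le> C * (weight \<alpha> T t)\<^sup>2 * (nrm \<Delta>)\<^sup>2"
    if T: "T\<^sub>0 \<le> T" and t: "t \<le> T" and d: "nrm \<Delta> < \<delta>" for T t \<Delta>
  proof
    have "nrm (z T \<Delta> t) \<le> ?m * nrm \<Delta> * weight \<alpha> T t"
      using P.solution_bound[OF small T z(1)[OF T d] z(3)[OF T d]] t
      by (simp add: weighted_norm_le_iff)
    also have "\<dots> = ?m * (weight \<alpha> T t * nrm \<Delta>)"
      by simp
    also have "\<dots> \<le> C * (weight \<alpha> T t * nrm \<Delta>)"
      using m by (intro mult_right_mono) (auto simp: C_def)
    also have "\<dots> \<le> C * (weight \<alpha> T t * nrm \<Delta>) + C * (weight \<alpha> T t)\<^sup>2 * (nrm \<Delta>)\<^sup>2"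
      using m by (simp add: C_def)
    finally show "nrm (z T \<Delta> t) \<le> C * weight \<alpha> T t * nrm \<Delta> + C * (weight \<alpha> T t)\<^sup>2 * (nrm \<Delta>)\<^sup>2"
      by (simp add: mult.assoc)
    have "nrm (z T \<Delta> t - bd_solution L B\<^sub>0 B\<^sub>T T \<Delta> t)
        \<le> P.K * ?m\<^sup>2 * (weight \<alpha> T t)\<^sup>2 * (nrm \<Delta>)\<^sup>2"
      by (rule P.error_bound[OF small T t z(1)[OF T d] z(3)[OF T d]])
    also have "\<dots> \<le> C * (weight \<alpha> T t)\<^sup>2 * (nrm \<Delta>)\<^sup>2"
      using m by (intro mult_right_mono) (auto simp: C_def)
    finally show "nrm (z T \<Delta> t - bd_solution L B\<^sub>0 B\<^sub>T T \<Delta> t) \<le> C * (weight \<alpha> T t)\<^sup>2 * (nrm \<Delta>)\<^sup>2" .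
  qed
  have pair: "nrm (z T \<Delta>\<^sub>1 t - z T \<Delta>\<^sub>2 t) \<le> C * weight \<alpha> T t * nrm (\<Delta>\<^sub>1 - \<Delta>\<^sub>2) \<and>
      nrm ((z T \<Delta>\<^sub>1 t - bd_solution L B\<^sub>0 B\<^sub>T T \<Delta>\<^sub>1 t) - (z T \<Delta>\<^sub>2 t - bd_solution L B\<^sub>0 B\<^sub>T T \<Delta>\<^sub>2 t))
        \<le> C * (weight \<alpha> T t)\<^sup>2 * (nrm \<Delta>\<^sub>1 + nrm \<Delta>\<^sub>2) * nrm (\<Delta>\<^sub>1 - \<Delta>\<^sub>2)"
    if T: "T\<^sub>0 \<le> T" and t: "t \<le> T" and d: "nrm \<Delta>\<^sub>1 < \<delta>" "nrm \<Delta>\<^sub>2 < \<delta>" for T t \<Delta>\<^sub>1 \<Delta>\<^sub>2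
  proof
    note sols = z(1)[OF T d(1)] z(3)[OF T d(1)] z(1)[OF T d(2)] z(3)[OF T d(2)]
    have "nrm (z T \<Delta>\<^sub>1 t - z T \<Delta>\<^sub>2 t) \<le> ?m * nrm (\<Delta>\<^sub>1 - \<Delta>\<^sub>2) * weight \<alpha> T t"
      using P.solution_lipschitz[OF small T sols] t
      unfolding weighted_norm_le_iff by blast
    also have "\<dots> = ?m * weight \<alpha> T t * nrm (\<Delta>\<^sub>1 - \<Delta>\<^sub>2)"
      by simp
    also have "\<dots> \<le> C * weight \<alpha> T t * nrm (\<Delta>\<^sub>1 - \<Delta>\<^sub>2)"
      using m by (intro mult_right_mono) (auto simp: C_def)
    finally show "nrm (z T \<Delta>\<^sub>1 t - z T \<Delta>\<^sub>2 t) \<le> C * weight \<alpha> T t * nrm (\<Delta>\<^sub>1 - \<Delta>\<^sub>2)" .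
    note P.error_lipschitz[OF small T t sols]
    also have "P.K * ?m\<^sup>2 * (weight \<alpha> T t)\<^sup>2 * (nrm \<Delta>\<^sub>1 + nrm \<Delta>\<^sub>2) * nrm (\<Delta>\<^sub>1 - \<Delta>\<^sub>2)
        \<le> C * (weight \<alpha> T t)\<^sup>2 * (nrm \<Delta>\<^sub>1 + nrm \<Delta>\<^sub>2) * nrm (\<Delta>\<^sub>1 - \<Delta>\<^sub>2)"
      using m by (intro mult_right_mono) (auto simp: C_def)
    finally show "nrm ((z T \<Delta>\<^sub>1 t - bd_solution L B\<^sub>0 B\<^sub>T T \<Delta>\<^sub>1 t)
        - (z T \<Delta>\<^sub>2 t - bd_solution L B\<^sub>0 B\<^sub>T T \<Delta>\<^sub>2 t))
      \<le> C * (weight \<alpha> T t)\<^sup>2 * (nrm \<Delta>\<^sub>1 + nrm \<Delta>\<^sub>2) * nrm (\<Delta>\<^sub>1 - \<Delta>\<^sub>2)" .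
  qed
  have unique: "y = z T \<Delta>"
    if "T\<^sub>0 \<le> T" "nrm \<Delta> < \<delta>" "nonlinear_bvp F B T \<Delta> y" "weighted_norm nrm \<alpha> T y \<le> R" for T \<Delta> y
    using P.solution_unique[OF small that(1,3,4)] z(1,3)[OF that(1,2)] by blast
  have frechet: "uniform_frechet_at_0 nrm \<alpha> T\<^sub>0 z (bd_solution L B\<^sub>0 B\<^sub>T)"
    using z(1,3) by (intro P.solution_family_frechet[OF small _ \<delta>]) blast
  show ?thesis
    unfolding Let_def
    using z(1,2) R_minus unique single pair frechet
    by (intro exI[of _ z] conjI exI[of _ C]) blast+
qed

end
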